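(* Let $g:\mathbb{R}\to\mathbb{R}$ be differentiable, monotone increasing and strictly convex, and consider the Weighted-Balanced-Utilization algorithm with $g$ on a given instance. Let $y_j$ be the probability that supply vertex $j\in S$ is matched in the first stage of the algorithm. Then the algorithm's value on this instance is at least $\big(\min_{j\in S}(1-y_j+y_j^2)\big)\cdot\mathrm{OPT}_{\mathrm{offline}}$.
   Context: Instance: finite bipartite graph $G=(D,S,E)$, $D=D_1\cup D_2$ disjoint, supply weights $w_j>0$, probabilities $\pi_i$ ($i\in D_2$). Each $i\in D_2$ is available independently w.p. $\pi_i$ (random set $\tilde D_2$). $\mathrm{MWM}(X,Y)$ = maximum over matchings of $G[X,Y]$ of total weight of matched supply vertices; $\mathrm{OPT}_{\mathrm{offline}}=\mathbb{E}[\mathrm{MWM}(D_1\cup\tilde D_2,S)]$. Algorithm: with $N(\cdot)$ neighbourhoods in $G[D_1,S]$, compute an optimal $x^*$ of: minimize $\sum_{j\in S}\frac1{w_j}g(w_j(1-\sum_{i\in N(j)}x_{ij}))$ s.t. $\sum_{j\in N(i)}x_{ij}\le1$ ($i\in D_1$), $\sum_{i\in N(j)}x_{ij}\le1$ ($j\in S$), $x\ge0$; sample a matching $M_1$ of $G[D_1,S]$ with $\Pr[(i,j)\in M_1]=x^*_{ij}$ (so $y_j=\sum_{i\in N(j)}x^*_{ij}$); in the second stage output a maximum supply-weighted matching $M_2$ between $\tilde D_2$ and supply vertices unmatched by $M_1$. The algorithm's value is $\mathbb{E}[\sum_j w_j\mathbf1\{j\text{ matched in }M_1\cup M_2\}]$.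 *)

theory Defs
  imports "HOL-Probability.Probability"
begin

text \<open>Demand and supply vertices live in two different types, so a bipartite graph is given by
  its vertex sets together with a set of pairs (demand, supply).\<close>

definition two_stage_instance ::
  "'d set \<Rightarrow> 'd set \<Rightarrow> 's set \<Rightarrow> ('d \<times> 's) set \<Rightarrow> ('s \<Rightarrow> real) \<Rightarrow> ('d \<Rightarrow> real) \<Rightarrow> bool" where
  "two_stage_instance D\<^sub>1 D\<^sub>2 S E w \<pi> \<longleftrightarrow>
     finite D\<^sub>1 \<and> finite D\<^sub>2 \<and> finite S \<and> D\<^sub>1 \<inter> D\<^sub>2 = {} \<and> E \<subseteq> (D\<^sub>1 \<union> D\<^sub>2) \<times> S \<and>
     (\<forall>j\<in>S. 0 < w j) \<and> (\<forall>i\<in>D\<^sub>2. 0 \<le> \<pi> i \<and> \<pi> i \<le> 1)"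

text \<open>Matchings of the induced subgraph \<open>G[X, Y]\<close>.\<close>

definition is_matching :: "('d \<times> 's) set \<Rightarrow> 'd set \<Rightarrow> 's set \<Rightarrow> ('d \<times> 's) set \<Rightarrow> bool" where
  "is_matching E X Y M \<longleftrightarrow> M \<subseteq> E \<inter> X \<times> Y \<and> inj_on fst M \<and> inj_on snd M"

definition matched_supply :: "('d \<times> 's) set \<Rightarrow> 's set" where
  "matched_supply M = snd ` M"

definition supply_weight :: "('s \<Rightarrow> real) \<Rightarrow> ('d \<times> 's) set \<Rightarrow> real" where
  "supply_weight w M = (\<Sum>j\<in>matched_supply M. w j)"

definition MWM :: "('d \<times> 's) set \<Rightarrow> ('s \<Rightarrow> real) \<Rightarrow> 'd set \<Rightarrow> 's set \<Rightarrow> real" where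
  "MWM E w X Y = Max (supply_weight w ` {M. is_matching E X Y M})"

definition is_max_weight_matching ::
  "('d \<times> 's) set \<Rightarrow> ('s \<Rightarrow> real) \<Rightarrow> 'd set \<Rightarrow> 's set \<Rightarrow> ('d \<times> 's) set \<Rightarrow> bool" where
  "is_max_weight_matching E w X Y M \<longleftrightarrow>
     is_matching E X Y M \<and> supply_weight w M = MWM E w X Y"

text \<open>The law of the random set of available second-stage demand vertices.\<close>

definition available_pmf :: "'d set \<Rightarrow> ('d \<Rightarrow> real) \<Rightarrow> 'd set pmf" where
  "available_pmf D\<^sub>2 \<pi> =
     map_pmf (\<lambda>a. {i\<in>D\<^sub>2. a i}) (Pi_pmf D\<^sub>2 False (\<lambda>i. bernoulli_pmf (\<pi> i)))"

definition OPT_offline ::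
  "'d set \<Rightarrow> 'd set \<Rightarrow> 's set \<Rightarrow> ('d \<times> 's) set \<Rightarrow> ('s \<Rightarrow> real) \<Rightarrow> ('d \<Rightarrow> real) \<Rightarrow> real" where
  "OPT_offline D\<^sub>1 D\<^sub>2 S E w \<pi> =
     measure_pmf.expectation (available_pmf D\<^sub>2 \<pi>) (\<lambda>T. MWM E w (D\<^sub>1 \<union> T) S)"

definition wbu_feasible ::
  "'d set \<Rightarrow> 's set \<Rightarrow> ('d \<times> 's) set \<Rightarrow> ('d \<Rightarrow> 's \<Rightarrow> real) \<Rightarrow> bool" where
  "wbu_feasible D\<^sub>1 S E x \<longleftrightarrow>
     (\<forall>i\<in>D\<^sub>1. (\<Sum>j | j \<in> S \<and> (i, j) \<in> E. x i j) \<le> 1) \<and>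
     (\<forall>j\<in>S. (\<Sum>i | i \<in> D\<^sub>1 \<and> (i, j) \<in> E. x i j) \<le> 1) \<and>
     (\<forall>i\<in>D\<^sub>1. \<forall>j\<in>S. (i, j) \<in> E \<longrightarrow> 0 \<le> x i j)"

definition wbu_objective ::
  "'d set \<Rightarrow> 's set \<Rightarrow> ('d \<times> 's) set \<Rightarrow> ('s \<Rightarrow> real) \<Rightarrow> (real \<Rightarrow> real) \<Rightarrow> ('d \<Rightarrow> 's \<Rightarrow> real) \<Rightarrow> real"
  where
  "wbu_objective D\<^sub>1 S E w g x =
     (\<Sum>j\<in>S. 1 / w j * g (w j * (1 - (\<Sum>i | i \<in> D\<^sub>1 \<and> (i, j) \<in> E. x i j))))"

definition wbu_optimal ::
  "'d set \<Rightarrow> 's set \<Rightarrow> ('d \<times> 's) set \<Rightarrow> ('s \<Rightarrow> real) \<Rightarrow> (real \<Rightarrow> real) \<Rightarrow> ('d \<Rightarrow> 's \<Rightarrow> real) \<Rightarrow> bool"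
  where
  "wbu_optimal D\<^sub>1 S E w g x \<longleftrightarrow>
     wbu_feasible D\<^sub>1 S E x \<and>
     (\<forall>x'. wbu_feasible D\<^sub>1 S E x' \<longrightarrow> wbu_objective D\<^sub>1 S E w g x \<le> wbu_objective D\<^sub>1 S E w g x')"

text \<open>A first-stage sampling: a law on the matchings of \<open>G[D\<^sub>1, S]\<close> whose edge marginals are \<open>x\<close>.
  Apart from the marginals the joint law is left arbitrary.\<close>

definition wbu_first_stage ::
  "'d set \<Rightarrow> 's set \<Rightarrow> ('d \<times> 's) set \<Rightarrow> ('d \<Rightarrow> 's \<Rightarrow> real) \<Rightarrow> ('d \<times> 's) set pmf \<Rightarrow> bool" where
  "wbu_first_stage D\<^sub>1 S E x \<mu> \<longleftrightarrow>
     (\<forall>M\<^sub>1\<in>set_pmf \<mu>. is_matching E D\<^sub>1 S M\<^sub>1) \<and>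
     (\<forall>i\<in>D\<^sub>1. \<forall>j\<in>S. (i, j) \<in> E \<longrightarrow> measure_pmf.prob \<mu> {M\<^sub>1. (i, j) \<in> M\<^sub>1} = x i j)"

text \<open>A second-stage rule: given \<open>M\<^sub>1\<close> and the set \<open>T\<close> of available demand vertices, it outputs a
  maximum supply-weighted matching of \<open>T\<close> with the supply left unmatched by \<open>M\<^sub>1\<close>. It is a
  probability kernel, so that ties may be broken in any, possibly randomized, way.\<close>

definition wbu_second_stage ::
  "'d set \<Rightarrow> 's set \<Rightarrow> ('d \<times> 's) set \<Rightarrow> ('s \<Rightarrow> real) \<Rightarrow> ('d \<Rightarrow> real) \<Rightarrow> ('d \<times> 's) set pmf \<Rightarrow>
   (('d \<times> 's) set \<Rightarrow> 'd set \<Rightarrow> ('d \<times> 's) set pmf) \<Rightarrow> bool" where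
  "wbu_second_stage D\<^sub>2 S E w \<pi> \<mu> \<kappa> \<longleftrightarrow>
     (\<forall>M\<^sub>1\<in>set_pmf \<mu>. \<forall>T\<in>set_pmf (available_pmf D\<^sub>2 \<pi>). \<forall>M\<^sub>2\<in>set_pmf (\<kappa> M\<^sub>1 T).
        is_max_weight_matching E w T (S - matched_supply M\<^sub>1) M\<^sub>2)"

text \<open>The law of the output \<open>M\<^sub>1 \<union> M\<^sub>2\<close>; the first-stage sample is independent of the set of
  available demand vertices.\<close>

definition wbu_output ::
  "'d set \<Rightarrow> ('d \<Rightarrow> real) \<Rightarrow> ('d \<times> 's) set pmf \<Rightarrow>
   (('d \<times> 's) set \<Rightarrow> 'd set \<Rightarrow> ('d \<times> 's) set pmf) \<Rightarrow> ('d \<times> 's) set pmf" where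
  "wbu_output D\<^sub>2 \<pi> \<mu> \<kappa> =
     bind_pmf \<mu> (\<lambda>M\<^sub>1. bind_pmf (available_pmf D\<^sub>2 \<pi>) (\<lambda>T. map_pmf (\<lambda>M\<^sub>2. M\<^sub>1 \<union> M\<^sub>2) (\<kappa> M\<^sub>1 T)))"

definition wbu_value ::
  "'d set \<Rightarrow> 's set \<Rightarrow> ('s \<Rightarrow> real) \<Rightarrow> ('d \<Rightarrow> real) \<Rightarrow> ('d \<times> 's) set pmf \<Rightarrow>
   (('d \<times> 's) set \<Rightarrow> 'd set \<Rightarrow> ('d \<times> 's) set pmf) \<Rightarrow> real" where
  "wbu_value D\<^sub>2 S w \<pi> \<mu> \<kappa> =
     measure_pmf.expectation (wbu_output D\<^sub>2 \<pi> \<mu> \<kappa>)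
       (\<lambda>M. \<Sum>j\<in>S. w j * indicator (matched_supply M) j)"

definition strictly_convex :: "(real \<Rightarrow> real) \<Rightarrow> bool" where
  "strictly_convex g \<longleftrightarrow>
     (\<forall>a b t. a \<noteq> b \<longrightarrow> 0 < t \<longrightarrow> t < 1 \<longrightarrow> g ((1 - t) * a + t * b) < (1 - t) * g a + t * g b)"

end

theory Submission
  imports Defs
begin

text \<open>
  Let \<open>v\<^sub>j = w\<^sub>j (1 - y\<^sub>j)\<close>. Shifting a little mass of \<open>x\<^sub>i\<close> towards a neighbour \<open>k\<close> with larger
  \<open>v\<^sub>k\<close> would decrease the strictly convex objective, so optimality gives
  \<open>v\<^sub>k \<le> \<Sum>\<^sub>j x\<^sub>i\<^sub>j v\<^sub>j\<close> for every edge \<open>(i, k)\<close>. Summing along a matching of \<open>D\<^sub>1\<close> to a supply set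
  \<open>A\<close> yields \<open>\<Sum>\<^sub>A w (1 - y) \<le> \<Sum>\<^sub>S w y (1 - y)\<close>.

  Fix the available set \<open>T\<close> and split an offline optimum into the supply \<open>A\<close> served by \<open>D\<^sub>1\<close> and
  the supply \<open>B\<close> served by \<open>T\<close>. What remains of \<open>B\<close> after the first stage can still be matched,
  so the algorithm earns at least \<open>\<Sum>\<^sub>S w y + \<Sum>\<^sub>B w (1 - y)\<close>. Writing \<open>y = y\<^sup>2 + y (1 - y)\<close> and
  \<open>C = A \<union> B\<close>, the bound for \<open>A\<close> makes this at least
  \<open>\<Sum>\<^sub>S w y\<^sup>2 + \<Sum>\<^sub>C w (1 - y) \<ge> \<Sum>\<^sub>C w (1 - y + y\<^sup>2)\<close>, while the offline optimum is \<open>\<Sum>\<^sub>C w\<close>.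
\<close>

section \<open>Strictly convex functions\<close>

lemma strictly_convex_adjacent_slope_less:
  assumes "strictly_convex g" "a < b" "b < c"
  shows "(g b - g a) / (b - a) < (g c - g b) / (c - b)"
proof -
  define t where "t = (b - a) / (c - a)"
  have "0 < t" "t < 1" and t_eq: "t * (c - a) = b - a"
    using assms by (auto simp: t_def field_simps)
  then have "g ((1 - t) * a + t * c) < (1 - t) * g a + t * g c"
    using assms by (auto simp: strictly_convex_def)
  also have "(1 - t) * a + t * c = b"
    using t_eq by (simp add: algebra_simps)
  finally have "(c - a) * g b < (c - a) * ((1 - t) * g a + t * g c)"
    using assms by simp
  also have "\<dots> = (c - a) * g a + (t * (c - a)) * (g c - g a)"
    by (simp add: algebra_simps)
  finally have "(c - a) * g b < (c - a) * g a + (b - a) * (g c - g a)"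
    unfolding t_eq .
  then show ?thesis
    using assms by (simp add: field_simps)
qed

lemma strictly_convex_slope_less:
  assumes "strictly_convex g" "a < b" "b < c" "c < d"
  shows "(g b - g a) / (b - a) < (g d - g c) / (d - c)"
  using strictly_convex_adjacent_slope_less[of g a b c]
    strictly_convex_adjacent_slope_less[of g b c d] assms
  by linarith

lemma strictly_convex_scaled_increment_less:
  assumes "strictly_convex g" "0 < a" "0 < b" "0 < e" "p + a * e < q - b * e"
  shows "(g (p + a * e) - g p) / a < (g q - g (q - b * e)) / b"
proof -
  have "(g (p + a * e) - g p) / (p + a * e - p) < (g q - g (q - b * e)) / (q - (q - b * e))"
    using assms by (intro strictly_convex_slope_less) auto
  then have "(g (p + a * e) - g p) / a / e < (g q - g (q - b * e)) / b / e"
    by simp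
  then show ?thesis
    using \<open>0 < e\<close> by (simp only: divide_less_cancel)
qed

lemma mono_strictly_convex_imp_strict_mono:
  assumes "mono g" "strictly_convex g"
  shows "strict_mono g"
proof (rule strict_monoI)
  fix a b :: real
  assume "a < b"
  have "0 \<le> (g a - g (a - 1)) / (a - (a - 1))"
    using monoD[OF assms(1), of "a - 1" a] by simp
  also have "\<dots> < (g b - g a) / (b - a)"
    using \<open>a < b\<close> by (intro strictly_convex_adjacent_slope_less assms(2)) auto
  finally show "g a < g b"
    using \<open>a < b\<close> by (simp add: zero_less_divide_iff)
qed

section \<open>Perturbing a fractional allocation\<close>

definition demand_load :: "'s set \<Rightarrow> ('d \<times> 's) set \<Rightarrow> ('d \<Rightarrow> 's \<Rightarrow> real) \<Rightarrow> 'd \<Rightarrow> real" where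
  "demand_load S E x i = (\<Sum>j | j \<in> S \<and> (i, j) \<in> E. x i j)"

definition supply_load :: "'d set \<Rightarrow> ('d \<times> 's) set \<Rightarrow> ('d \<Rightarrow> 's \<Rightarrow> real) \<Rightarrow> 's \<Rightarrow> real" where
  "supply_load D E x j = (\<Sum>i | i \<in> D \<and> (i, j) \<in> E. x i j)"

definition residual_weight ::
  "'d set \<Rightarrow> ('d \<times> 's) set \<Rightarrow> ('s \<Rightarrow> real) \<Rightarrow> ('d \<Rightarrow> 's \<Rightarrow> real) \<Rightarrow> 's \<Rightarrow> real" where
  "residual_weight D E w x j = w j * (1 - supply_load D E x j)"

definition add_mass :: "'d \<Rightarrow> 's \<Rightarrow> real \<Rightarrow> ('d \<Rightarrow> 's \<Rightarrow> real) \<Rightarrow> 'd \<Rightarrow> 's \<Rightarrow> real" where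
  "add_mass i k e x = x(i := (x i)(k := x i k + e))"

lemma add_mass_apply: "add_mass i k e x i' j = x i' j + (if i' = i \<and> j = k then e else 0)"
  by (simp add: add_mass_def)

lemma wbu_feasible_iff_loads:
  "wbu_feasible D S E x \<longleftrightarrow>
     (\<forall>i\<in>D. demand_load S E x i \<le> 1) \<and> (\<forall>j\<in>S. supply_load D E x j \<le> 1) \<and>
     (\<forall>i\<in>D. \<forall>j\<in>S. (i, j) \<in> E \<longrightarrow> 0 \<le> x i j)"
  by (simp add: wbu_feasible_def demand_load_def supply_load_def)

lemma demand_load_add_mass:
  assumes "finite S" "k \<in> S" "(i, k) \<in> E"
  shows "demand_load S E (add_mass i k e x) i' = demand_load S E x i' + (if i' = i then e else 0)"
  using assms by (simp add: demand_load_def add_mass_apply sum.distrib)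

lemma supply_load_add_mass:
  assumes "finite D" "i \<in> D" "(i, k) \<in> E"
  shows "supply_load D E (add_mass i k e x) j = supply_load D E x j + (if j = k then e else 0)"
  using assms by (simp add: supply_load_def add_mass_apply sum.distrib)

lemma residual_weight_add_mass:
  assumes "finite D" "i \<in> D" "(i, k) \<in> E"
  shows "residual_weight D E w (add_mass i k e x) j =
    residual_weight D E w x j - (if j = k then w k * e else 0)"
  using assms by (simp add: residual_weight_def supply_load_add_mass algebra_simps)

lemma wbu_feasible_add_mass:
  assumes "finite D" "finite S" "wbu_feasible D S E x" "i \<in> D" "k \<in> S" "(i, k) \<in> E"
    and "0 \<le> x i k + e" "demand_load S E x i + e \<le> 1" "supply_load D E x k + e \<le> 1"
  shows "wbu_feasible D S E (add_mass i k e x)"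
  using assms
  by (auto simp: wbu_feasible_iff_loads demand_load_add_mass supply_load_add_mass add_mass_apply)

lemma wbu_objective_add_mass:
  assumes "finite D" "finite S" "i \<in> D" "k \<in> S" "(i, k) \<in> E"
  shows "wbu_objective D S E w g (add_mass i k e x) = wbu_objective D S E w g x
    + (g (residual_weight D E w x k - w k * e) - g (residual_weight D E w x k)) / w k"
proof -
  have objective: "wbu_objective D S E w g z = (\<Sum>j\<in>S. g (residual_weight D E w z j) / w j)" for z
    by (simp add: wbu_objective_def residual_weight_def supply_load_def)
  show ?thesis
    using assms
    by (simp add: objective residual_weight_add_mass sum.remove[of S k] diff_divide_distrib)
qed

section \<open>Optimality of the first stage\<close>

locale wbu_optimum =
  fixes D :: "'d set" and S :: "'s set" and E :: "('d \<times> 's) set"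
    and w :: "'s \<Rightarrow> real" and g :: "real \<Rightarrow> real" and x :: "'d \<Rightarrow> 's \<Rightarrow> real"
  assumes finite_demand: "finite D" and finite_supply: "finite S"
    and weight_pos: "j \<in> S \<Longrightarrow> 0 < w j"
    and mono_g: "mono g" and strictly_convex_g: "strictly_convex g"
    and optimal: "wbu_optimal D S E w g x"
begin

abbreviation load :: "'s \<Rightarrow> real" where
  "load \<equiv> supply_load D E x"

abbreviation residual :: "'s \<Rightarrow> real" where
  "residual \<equiv> residual_weight D E w x"

lemma feasible: "wbu_feasible D S E x"
  using optimal by (simp add: wbu_optimal_def)

lemma allocation_nonneg: "i \<in> D \<Longrightarrow> j \<in> S \<Longrightarrow> (i, j) \<in> E \<Longrightarrow> 0 \<le> x i j"
  using feasible by (simp add: wbu_feasible_def)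

lemma demand_load_le_1: "i \<in> D \<Longrightarrow> demand_load S E x i \<le> 1"
  using feasible by (simp add: wbu_feasible_iff_loads)

lemma load_le_1: "j \<in> S \<Longrightarrow> load j \<le> 1"
  using feasible by (simp add: wbu_feasible_iff_loads)

lemma objective_le:
  "wbu_feasible D S E z \<Longrightarrow> wbu_objective D S E w g x \<le> wbu_objective D S E w g z"
  using optimal by (simp add: wbu_optimal_def)

lemma residual_nonneg: "j \<in> S \<Longrightarrow> 0 \<le> residual j"
  using load_le_1 weight_pos by (simp add: residual_weight_def less_imp_le)

lemma residual_pos_iff: "j \<in> S \<Longrightarrow> 0 < residual j \<longleftrightarrow> load j < 1"
  using weight_pos[of j] by (simp add: residual_weight_def zero_less_mult_iff)

lemma weighted_residual_nonneg:
  "i \<in> D \<Longrightarrow> 0 \<le> (\<Sum>j | j \<in> S \<and> (i, j) \<in> E. x i j * residual j)"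
  by (intro sum_nonneg mult_nonneg_nonneg) (auto intro: allocation_nonneg residual_nonneg)

lemma demand_load_eq_1:
  assumes demand: "i \<in> D" and edge_k: "k \<in> S" "(i, k) \<in> E" and "0 < residual k"
  shows "demand_load S E x i = 1"
proof (rule ccontr)
  assume "demand_load S E x i \<noteq> 1"
  then have slack: "demand_load S E x i < 1" "load k < 1"
    using demand_load_le_1[OF demand] \<open>0 < residual k\<close> edge_k(1) by (auto simp: residual_pos_iff)
  define e where "e = min (1 - demand_load S E x i) (1 - load k)"
  have "0 < e" and e_fits: "demand_load S E x i + e \<le> 1" "load k + e \<le> 1"
    using slack by (auto simp: e_def)
  have "wbu_feasible D S E (add_mass i k e x)"
    using \<open>0 < e\<close> e_fits allocation_nonneg[OF demand edge_k] feasible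
      finite_demand finite_supply demand edge_k
    by (intro wbu_feasible_add_mass) auto
  then have "0 \<le> (g (residual k - w k * e) - g (residual k)) / w k"
    using objective_le
      wbu_objective_add_mass[OF finite_demand finite_supply demand edge_k, of w g e x]
    by fastforce
  moreover have "g (residual k - w k * e) < g (residual k)"
    using mono_strictly_convex_imp_strict_mono[OF mono_g strictly_convex_g]
      \<open>0 < e\<close> weight_pos[OF edge_k(1)]
    by (simp add: strict_mono_less)
  ultimately show False
    using weight_pos[OF edge_k(1)] by (simp add: zero_le_divide_iff)
qed

lemma exchange_marginal_le:
  assumes demand: "i \<in> D" and edge_j: "j \<in> S" "(i, j) \<in> E" and edge_k: "k \<in> S" "(i, k) \<in> E"
    and "j \<noteq> k"
    and e_bounds: "0 \<le> e" "e \<le> x i j" "e \<le> 1 - load k"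
  shows "(g (residual k) - g (residual k - w k * e)) / w k
       \<le> (g (residual j + w j * e) - g (residual j)) / w j"
proof -
  note finite = finite_demand finite_supply
  let ?z = "add_mass i j (- e) x"
  have feasible_z: "wbu_feasible D S E ?z"
    using e_bounds demand_load_le_1[OF demand] load_le_1[OF edge_j(1)] feasible finite demand edge_j
    by (intro wbu_feasible_add_mass) auto
  have "wbu_feasible D S E (add_mass i k e ?z)"
  proof (rule wbu_feasible_add_mass[OF finite feasible_z demand edge_k])
    show "0 \<le> ?z i k + e"
      using allocation_nonneg[OF demand edge_k] e_bounds \<open>j \<noteq> k\<close> by (simp add: add_mass_apply)
    show "demand_load S E ?z i + e \<le> 1"
      using demand_load_le_1[OF demand] by (simp add: demand_load_add_mass[OF finite(2) edge_j])
    show "supply_load D E ?z k + e \<le> 1"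
      using e_bounds \<open>j \<noteq> k\<close> by (simp add: supply_load_add_mass[OF finite(1) demand edge_j(2)])
  qed
  then have "wbu_objective D S E w g x \<le> wbu_objective D S E w g (add_mass i k e ?z)"
    by (rule objective_le)
  also have "\<dots> = wbu_objective D S E w g x
      + (g (residual j + w j * e) - g (residual j)) / w j
      + (g (residual k - w k * e) - g (residual k)) / w k"
    using \<open>j \<noteq> k\<close>
    by (simp add: wbu_objective_add_mass finite demand edge_j edge_k residual_weight_add_mass)
  finally show ?thesis
    by (simp add: diff_divide_distrib)
qed

lemma residual_le_residual_support:
  assumes demand: "i \<in> D" and edge_j: "j \<in> S" "(i, j) \<in> E" and edge_k: "k \<in> S" "(i, k) \<in> E"
    and "0 < x i j"
  shows "residual k \<le> residual j"
proof (rule ccontr)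
  assume "\<not> residual k \<le> residual j"
  then have less: "residual j < residual k" and "j \<noteq> k"
    by auto
  then have "load k < 1"
    using residual_nonneg[OF edge_j(1)] residual_pos_iff[OF edge_k(1)] by linarith
  have weights_pos: "0 < w j" "0 < w k"
    using weight_pos edge_j edge_k by auto
  let ?gap = "(residual k - residual j) / (w j + w k)"
  obtain e where "0 < e" and e_less: "e < min (x i j) (min (1 - load k) ?gap)"
    using dense[of 0 "min (x i j) (min (1 - load k) ?gap)"]
      \<open>0 < x i j\<close> \<open>load k < 1\<close> less weights_pos
    by auto
  have "e * (w j + w k) < residual k - residual j"
    using e_less weights_pos by (simp add: pos_less_divide_eq)
  then have separated: "residual j + w j * e < residual k - w k * e"
    by (simp add: algebra_simps)
  have "(g (residual j + w j * e) - g (residual j)) / w j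
      < (g (residual k) - g (residual k - w k * e)) / w k"
    using strictly_convex_g weights_pos \<open>0 < e\<close> separated
    by (rule strictly_convex_scaled_increment_less)
  moreover have "(g (residual k) - g (residual k - w k * e)) / w k
      \<le> (g (residual j + w j * e) - g (residual j)) / w j"
    using \<open>0 < e\<close> e_less by (intro exchange_marginal_le[OF demand edge_j edge_k \<open>j \<noteq> k\<close>]) auto
  ultimately show False
    by linarith
qed

lemma residual_le_weighted_residual:
  assumes demand: "i \<in> D" and edge_k: "k \<in> S" "(i, k) \<in> E"
  shows "residual k \<le> (\<Sum>j | j \<in> S \<and> (i, j) \<in> E. x i j * residual j)"
proof (cases "0 < residual k")
  case True
  have "residual k = (\<Sum>j | j \<in> S \<and> (i, j) \<in> E. x i j * residual k)"
    using demand_load_eq_1[OF demand edge_k True]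
    by (simp add: demand_load_def flip: sum_distrib_right)
  also have "\<dots> \<le> (\<Sum>j | j \<in> S \<and> (i, j) \<in> E. x i j * residual j)"
  proof (rule sum_mono)
    fix j
    assume "j \<in> {j. j \<in> S \<and> (i, j) \<in> E}"
    then show "x i j * residual k \<le> x i j * residual j"
      using allocation_nonneg[OF demand, of j]
        residual_le_residual_support[OF demand _ _ edge_k, of j]
      by (cases "x i j = 0") (auto intro: mult_left_mono)
  qed
  finally show ?thesis .
next
  case False
  then show ?thesis
    using weighted_residual_nonneg[OF demand] by linarith
qed

lemma sum_residual_matching_le:
  assumes "is_matching E D S M"
  shows "(\<Sum>j\<in>matched_supply M. residual j) \<le> (\<Sum>j\<in>S. load j * residual j)"
proof -
  let ?weighted = "\<lambda>i. \<Sum>j | j \<in> S \<and> (i, j) \<in> E. x i j * residual j"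
  have edges: "M \<subseteq> E \<inter> D \<times> S" and inj: "inj_on fst M" "inj_on snd M"
    using assms by (auto simp: is_matching_def)
  have "(\<Sum>j\<in>matched_supply M. residual j) = (\<Sum>a\<in>M. residual (snd a))"
    by (simp add: matched_supply_def sum.reindex[OF inj(2)])
  also have "\<dots> \<le> (\<Sum>a\<in>M. ?weighted (fst a))"
    using edges by (intro sum_mono residual_le_weighted_residual) auto
  also have "\<dots> = sum ?weighted (fst ` M)"
    by (simp add: sum.reindex[OF inj(1)])
  also have "\<dots> \<le> sum ?weighted D"
    using edges finite_demand weighted_residual_nonneg by (intro sum_mono2) auto
  also have "\<dots> = (\<Sum>j\<in>S. \<Sum>i | i \<in> D \<and> (i, j) \<in> E. x i j * residual j)"
    using finite_demand finite_supply by (rule sum.swap_restrict)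
  also have "\<dots> = (\<Sum>j\<in>S. load j * residual j)"
    by (simp add: supply_load_def sum_distrib_right)
  finally show ?thesis .
qed

end

section \<open>Matchings\<close>

lemma matched_supply_Un: "matched_supply (M \<union> N) = matched_supply M \<union> matched_supply N"
  by (simp add: matched_supply_def image_Un)

lemma matched_supply_subset: "is_matching E X Y M \<Longrightarrow> matched_supply M \<subseteq> Y"
  by (auto simp: is_matching_def matched_supply_def)

lemma is_matching_restrict:
  assumes "is_matching E X Y M" "N \<subseteq> M" "N \<subseteq> X' \<times> Y'"
  shows "is_matching E X' Y' N"
  using assms by (auto simp: is_matching_def intro: inj_on_subset)

lemma finite_matchings:
  assumes "finite X" "finite Y"
  shows "finite {M. is_matching E X Y M}"
  by (rule finite_subset[of _ "Pow (X \<times> Y)"]) (use assms in \<open>auto simp: is_matching_def\<close>)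

lemma MWM_attained:
  assumes "finite X" "finite Y"
  obtains M where "is_matching E X Y M" "supply_weight w M = MWM E w X Y"
proof -
  have "is_matching E X Y {}"
    by (simp add: is_matching_def)
  then have "MWM E w X Y \<in> supply_weight w ` {M. is_matching E X Y M}"
    unfolding MWM_def using finite_matchings[OF assms] by (intro Max_in) auto
  then show ?thesis
    using that by auto
qed

lemma supply_weight_le_MWM:
  assumes "finite X" "finite Y" "is_matching E X Y M"
  shows "supply_weight w M \<le> MWM E w X Y"
  unfolding MWM_def using finite_matchings[OF assms(1,2)] assms(3) by (intro Max_ge) auto

lemma MWM_Un_demand_split:
  assumes "finite X" "finite X'" "finite Y" "X \<inter> X' = {}"
  obtains M M' where "is_matching E X Y M" "is_matching E X' Y M'"
    "matched_supply M \<inter> matched_supply M' = {}"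
    "MWM E w (X \<union> X') Y = supply_weight w M + supply_weight w M'"
proof -
  obtain L where matching_L: "is_matching E (X \<union> X') Y L"
    and weight_L: "supply_weight w L = MWM E w (X \<union> X') Y"
    using assms by (auto intro: MWM_attained[of "X \<union> X'" Y E w])
  define M M' where "M = L \<inter> X \<times> Y" and "M' = L \<inter> X' \<times> Y"
  have matchings: "is_matching E X Y M" "is_matching E X' Y M'"
    by (auto simp: M_def M'_def intro: is_matching_restrict[OF matching_L])
  have "L = M \<union> M'" "M \<inter> M' = {}" "inj_on snd L"
    using matching_L \<open>X \<inter> X' = {}\<close> by (auto simp: is_matching_def M_def M'_def)
  then have disjoint: "matched_supply M \<inter> matched_supply M' = {}"
    unfolding matched_supply_def by (metis inj_on_image_Int image_empty sup_ge1 sup_ge2)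
  have "finite (matched_supply M)" "finite (matched_supply M')"
    using matchings \<open>finite Y\<close> by (meson finite_subset matched_supply_subset)+
  then have "supply_weight w L = supply_weight w M + supply_weight w M'"
    by (simp add: supply_weight_def \<open>L = M \<union> M'\<close> matched_supply_Un sum.union_disjoint disjoint)
  then show thesis
    using that matchings disjoint weight_L by simp
qed

lemma max_weight_matching_residual_ge:
  assumes "finite X" "finite Y" "is_max_weight_matching E w X (Y - R) M" "is_matching E X Y N"
  shows "sum w (matched_supply N - R) \<le> supply_weight w M"
proof -
  let ?N = "{a \<in> N. snd a \<notin> R}"
  have "is_matching E X (Y - R) ?N"
    using assms(4) by (rule is_matching_restrict) (use assms(4) in \<open>auto simp: is_matching_def\<close>)
  then have "supply_weight w ?N \<le> MWM E w X (Y - R)"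
    using assms(1,2) by (intro supply_weight_le_MWM) auto
  moreover have "matched_supply ?N = matched_supply N - R"
    by (auto simp: matched_supply_def)
  ultimately show ?thesis
    using assms(3) by (simp add: supply_weight_def is_max_weight_matching_def)
qed

lemma two_stage_matched_weight_ge:
  assumes "finite X" "finite S" "is_max_weight_matching E w X (S - matched_supply M\<^sub>1) M\<^sub>2"
    and "is_matching E X S N"
  shows "sum w (S \<inter> matched_supply M\<^sub>1) + sum w (matched_supply N - matched_supply M\<^sub>1)
       \<le> sum w (S \<inter> matched_supply (M\<^sub>1 \<union> M\<^sub>2))"
proof -
  have "matched_supply M\<^sub>2 \<subseteq> S - matched_supply M\<^sub>1"
    using assms(3) by (auto simp: is_max_weight_matching_def dest: matched_supply_subset)
  then have "S \<inter> matched_supply (M\<^sub>1 \<union> M\<^sub>2) = (S \<inter> matched_supply M\<^sub>1) \<union> matched_supply M\<^sub>2"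
    and "(S \<inter> matched_supply M\<^sub>1) \<inter> matched_supply M\<^sub>2 = {}" and "finite (matched_supply M\<^sub>2)"
    using \<open>finite S\<close> by (auto simp: matched_supply_Un intro: finite_subset)
  then have "sum w (S \<inter> matched_supply (M\<^sub>1 \<union> M\<^sub>2))
      = sum w (S \<inter> matched_supply M\<^sub>1) + supply_weight w M\<^sub>2"
    using \<open>finite S\<close> by (simp add: supply_weight_def sum.union_disjoint)
  then show ?thesis
    using max_weight_matching_residual_ge[OF assms] by simp
qed

section \<open>Expectations\<close>

lemma expectation_pmf_mono_finite:
  fixes f h :: "'a \<Rightarrow> real"
  assumes "finite (set_pmf p)" "\<And>a. a \<in> set_pmf p \<Longrightarrow> f a \<le> h a"
  shows "measure_pmf.expectation p f \<le> measure_pmf.expectation p h"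
  using assms by (intro integral_mono_AE integrable_measure_pmf_finite AE_pmfI)

lemma expectation_bind_pmf_finite:
  fixes h :: "'b \<Rightarrow> 'c :: {banach, second_countable_topology}"
  assumes "finite (set_pmf p)" "\<And>a. a \<in> set_pmf p \<Longrightarrow> finite (set_pmf (f a))"
  shows "measure_pmf.expectation (bind_pmf p f) h
       = measure_pmf.expectation p (\<lambda>a. measure_pmf.expectation (f a) h)"
  using pmf_expectation_bind[OF assms order_refl, where h = h] assms(1)
  by (simp add: integral_measure_pmf[of "set_pmf p"])

lemma expectation_le_expectation_bind_pmf:
  fixes h :: "'b \<Rightarrow> real"
  assumes finite_support: "finite (set_pmf p)" "\<And>a. a \<in> set_pmf p \<Longrightarrow> finite (set_pmf (f a))"
    and lower_bound: "\<And>a b. a \<in> set_pmf p \<Longrightarrow> b \<in> set_pmf (f a) \<Longrightarrow> l a \<le> h b"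
  shows "measure_pmf.expectation p l \<le> measure_pmf.expectation (bind_pmf p f) h"
proof -
  have "l a \<le> measure_pmf.expectation (f a) h" if "a \<in> set_pmf p" for a
    using finite_support(2) lower_bound that
    by (intro measure_pmf.integral_ge_const integrable_measure_pmf_finite AE_pmfI) auto
  then show ?thesis
    using finite_support by (simp add: expectation_bind_pmf_finite expectation_pmf_mono_finite)
qed

lemma expectation_sum_random_subset:
  fixes w :: "'b \<Rightarrow> real"
  assumes "finite B"
  shows "measure_pmf.expectation p (\<lambda>a. sum w (B \<inter> X a))
       = (\<Sum>j\<in>B. w j * measure_pmf.prob p {a. j \<in> X a})"
proof -
  have "sum w (B \<inter> X a) = (\<Sum>j\<in>B. w j * indicator {a. j \<in> X a} a)" for a
    using assms by (simp add: indicator_def sum.inter_restrict of_bool_def if_distrib cong: if_cong)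
  then show ?thesis
    by (simp add: less_top[symmetric])
qed

lemma expectation_sum_random_Diff:
  fixes w :: "'b \<Rightarrow> real"
  assumes "finite B"
  shows "measure_pmf.expectation p (\<lambda>a. sum w (B - X a))
       = (\<Sum>j\<in>B. w j * (1 - measure_pmf.prob p {a. j \<in> X a}))"
proof -
  have "measure_pmf.prob p {a. j \<notin> X a} = 1 - measure_pmf.prob p {a. j \<in> X a}" for j
    using measure_pmf.prob_neg[where P = "\<lambda>a. j \<in> X a" and M = p] by simp
  then show ?thesis
    using expectation_sum_random_subset[OF assms, where X = "\<lambda>a. - X a"] by (simp add: Diff_eq)
qed

section \<open>The value of the algorithm\<close>

lemma prob_matched_eq_supply_load:
  assumes "finite D" "wbu_first_stage D S E x \<mu>" "j \<in> S"
  shows "measure_pmf.prob \<mu> {M. j \<in> matched_supply M} = supply_load D E x j"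
proof -
  let ?I = "{i. i \<in> D \<and> (i, j) \<in> E}"
  have matching: "M \<subseteq> E \<inter> D \<times> S" "inj_on snd M" if "M \<in> set_pmf \<mu>" for M
    using assms(2) that by (auto simp: wbu_first_stage_def is_matching_def)
  have "measure_pmf.prob \<mu> {M. j \<in> matched_supply M}
      = measure_pmf.prob \<mu> (\<Union>i\<in>?I. {M. (i, j) \<in> M})"
    using matching(1)
    by (intro measure_pmf.finite_measure_eq_AE AE_pmfI) (force simp: matched_supply_def)+
  also have "\<dots> = (\<Sum>i\<in>?I. measure_pmf.prob \<mu> {M. (i, j) \<in> M})"
  proof (rule measure_UNION_AE)
    show "pairwise (\<lambda>i i'. AE M in \<mu>. M \<notin> {M. (i, j) \<in> M} \<or> M \<notin> {M. (i', j) \<in> M}) ?I"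
      using matching(2) by (fastforce simp: pairwise_def AE_measure_pmf_iff inj_on_def)
  qed (use assms(1) in \<open>auto simp: measure_pmf.fmeasurable_eq_sets\<close>)
  also have "\<dots> = supply_load D E x j"
    using assms(2,3) by (simp add: supply_load_def wbu_first_stage_def)
  finally show ?thesis .
qed

lemma finite_set_pmf_matchings:
  assumes "finite X" "finite Y" "\<And>M. M \<in> set_pmf p \<Longrightarrow> is_matching E X Y M"
  shows "finite (set_pmf p)"
  by (rule finite_subset[OF _ finite_matchings[OF assms(1,2), of E]]) (use assms(3) in auto)

lemma finite_set_pmf_first_stage:
  assumes "finite D" "finite S" "wbu_first_stage D S E x \<mu>"
  shows "finite (set_pmf \<mu>)"
  using assms by (intro finite_set_pmf_matchings[of D S]) (auto simp: wbu_first_stage_def)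

lemma finite_set_pmf_max_weight_matchings:
  assumes "finite X" "finite Y" "\<And>M. M \<in> set_pmf p \<Longrightarrow> is_max_weight_matching E w X Y M"
  shows "finite (set_pmf p)"
  using assms by (intro finite_set_pmf_matchings[of X Y]) (auto simp: is_max_weight_matching_def)

lemma available_pmf_subset: "T \<in> set_pmf (available_pmf D \<pi>) \<Longrightarrow> T \<subseteq> D"
  by (auto simp: available_pmf_def)

lemma finite_set_available_pmf: "finite D \<Longrightarrow> finite (set_pmf (available_pmf D \<pi>))"
  by (rule finite_subset[of _ "Pow D"]) (auto dest: available_pmf_subset)

definition scenario_value :: "'s set \<Rightarrow> ('s \<Rightarrow> real) \<Rightarrow> ('d \<times> 's) set pmf \<Rightarrow>
    (('d \<times> 's) set \<Rightarrow> ('d \<times> 's) set pmf) \<Rightarrow> real" where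
  "scenario_value S w \<mu> \<kappa> = measure_pmf.expectation
     (bind_pmf \<mu> (\<lambda>M. map_pmf ((\<union>) M) (\<kappa> M))) (\<lambda>M. sum w (S \<inter> matched_supply M))"

lemma wbu_value_eq_expectation_scenario_value:
  assumes "finite D\<^sub>2" "finite S" "finite (set_pmf \<mu>)" "wbu_second_stage D\<^sub>2 S E w \<pi> \<mu> \<kappa>"
  shows "wbu_value D\<^sub>2 S w \<pi> \<mu> \<kappa> =
    measure_pmf.expectation (available_pmf D\<^sub>2 \<pi>) (\<lambda>T. scenario_value S w \<mu> (\<lambda>M. \<kappa> M T))"
proof -
  have finite_\<kappa>: "finite (set_pmf (\<kappa> M T))"
    if "M \<in> set_pmf \<mu>" "T \<in> set_pmf (available_pmf D\<^sub>2 \<pi>)" for M T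
  proof (rule finite_set_pmf_max_weight_matchings)
    show "finite T"
      using available_pmf_subset[OF that(2)] \<open>finite D\<^sub>2\<close> by (rule finite_subset)
    show "is_max_weight_matching E w T (S - matched_supply M) N" if "N \<in> set_pmf (\<kappa> M T)" for N
      using assms(4) that \<open>M \<in> set_pmf \<mu>\<close> \<open>T \<in> set_pmf _\<close> by (simp add: wbu_second_stage_def)
  qed (use \<open>finite S\<close> in simp)
  have "wbu_value D\<^sub>2 S w \<pi> \<mu> \<kappa> = measure_pmf.expectation
      (bind_pmf (available_pmf D\<^sub>2 \<pi>) (\<lambda>T. bind_pmf \<mu> (\<lambda>M. map_pmf ((\<union>) M) (\<kappa> M T))))
      (\<lambda>M. \<Sum>j\<in>S. w j * indicator (matched_supply M) j)"
    unfolding wbu_value_def wbu_output_def by (subst bind_commute_pmf) (rule refl)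
  also have "\<dots> = measure_pmf.expectation (available_pmf D\<^sub>2 \<pi>) (\<lambda>T.
      measure_pmf.expectation (bind_pmf \<mu> (\<lambda>M. map_pmf ((\<union>) M) (\<kappa> M T)))
        (\<lambda>M. \<Sum>j\<in>S. w j * indicator (matched_supply M) j))"
    by (rule expectation_bind_pmf_finite) (use assms(1,3) finite_\<kappa> finite_set_available_pmf in auto)
  finally show ?thesis
    using \<open>finite S\<close> by (simp add: scenario_value_def sum_mult_indicator Int_def)
qed

lemma charging_inequality:
  fixes w y :: "'s \<Rightarrow> real"
  assumes "finite S" "A \<subseteq> S" "B \<subseteq> S" "A \<inter> B = {}"
    and weight_nonneg: "\<And>j. j \<in> S \<Longrightarrow> 0 \<le> w j"
    and ratio_le: "\<And>j. j \<in> S \<Longrightarrow> c \<le> 1 - y j + (y j)\<^sup>2"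
    and A_charged: "(\<Sum>j\<in>A. w j * (1 - y j)) \<le> (\<Sum>j\<in>S. w j * y j * (1 - y j))"
  shows "c * (sum w A + sum w B) \<le> (\<Sum>j\<in>S. w j * y j) + (\<Sum>j\<in>B. w j * (1 - y j))"
proof -
  have sum_AB: "sum f (A \<union> B) = sum f A + sum f B" for f :: "'s \<Rightarrow> real"
    using assms(1-4) by (intro sum.union_disjoint) (auto intro: finite_subset)
  have "c * (sum w A + sum w B) = (\<Sum>j\<in>A \<union> B. w j * c)"
    by (simp add: sum_AB sum_distrib_left distrib_left mult.commute)
  also have "\<dots> \<le> (\<Sum>j\<in>A \<union> B. w j * (1 - y j + (y j)\<^sup>2))"
    using assms(2,3) weight_nonneg ratio_le by (intro sum_mono mult_left_mono) auto
  also have "\<dots> = (\<Sum>j\<in>A \<union> B. w j * (y j)\<^sup>2) + (\<Sum>j\<in>A \<union> B. w j * (1 - y j))"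
    by (simp add: algebra_simps flip: sum.distrib)
  also have "\<dots> \<le> (\<Sum>j\<in>S. w j * (y j)\<^sup>2) + (\<Sum>j\<in>A \<union> B. w j * (1 - y j))"
    using assms(1-3) weight_nonneg by (intro add_right_mono sum_mono2) auto
  also have "\<dots> \<le> (\<Sum>j\<in>S. w j * (y j)\<^sup>2) + (\<Sum>j\<in>S. w j * y j * (1 - y j))
      + (\<Sum>j\<in>B. w j * (1 - y j))"
    using A_charged by (simp add: sum_AB)
  also have "(\<Sum>j\<in>S. w j * (y j)\<^sup>2) + (\<Sum>j\<in>S. w j * y j * (1 - y j)) = (\<Sum>j\<in>S. w j * y j)"
    by (simp add: algebra_simps power2_eq_square flip: sum.distrib)
  finally show ?thesis .
qed

lemma (in wbu_optimum) scaled_MWM_le_matching_bound: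
  assumes "finite T" "D \<inter> T = {}" and ratio_le: "\<And>j. j \<in> S \<Longrightarrow> c \<le> 1 - load j + (load j)\<^sup>2"
  obtains N where "is_matching E T S N"
    "c * MWM E w (D \<union> T) S
      \<le> (\<Sum>j\<in>S. w j * load j) + (\<Sum>j\<in>matched_supply N. w j * (1 - load j))"
proof -
  obtain M N where matchings: "is_matching E D S M" "is_matching E T S N"
    and disjoint: "matched_supply M \<inter> matched_supply N = {}"
    and MWM_eq: "MWM E w (D \<union> T) S = supply_weight w M + supply_weight w N"
    using MWM_Un_demand_split[OF finite_demand assms(1) finite_supply assms(2)] .
  have "(\<Sum>j\<in>matched_supply M. w j * (1 - load j)) \<le> (\<Sum>j\<in>S. w j * load j * (1 - load j))"
    using sum_residual_matching_le[OF matchings(1)] by (simp add: residual_weight_def ac_simps)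
  then have "c * MWM E w (D \<union> T) S
      \<le> (\<Sum>j\<in>S. w j * load j) + (\<Sum>j\<in>matched_supply N. w j * (1 - load j))"
    unfolding MWM_eq supply_weight_def
    by (intro charging_inequality finite_supply disjoint ratio_le
          matchings[THEN matched_supply_subset])
      (auto simp: weight_pos less_imp_le)
  then show thesis
    using that matchings(2) by blast
qed

lemma (in wbu_optimum) scaled_MWM_le_scenario_value:
  assumes "finite T" "D \<inter> T = {}" and first_stage: "wbu_first_stage D S E x \<mu>"
    and second_stage: "\<And>M N. M \<in> set_pmf \<mu> \<Longrightarrow> N \<in> set_pmf (\<kappa> M) \<Longrightarrow>
      is_max_weight_matching E w T (S - matched_supply M) N"
    and ratio_le: "\<And>j. j \<in> S \<Longrightarrow> c \<le> 1 - load j + (load j)\<^sup>2"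
  shows "c * MWM E w (D \<union> T) S \<le> scenario_value S w \<mu> \<kappa>"
proof -
  obtain N where matching_N: "is_matching E T S N"
    and MWM_le: "c * MWM E w (D \<union> T) S
      \<le> (\<Sum>j\<in>S. w j * load j) + (\<Sum>j\<in>matched_supply N. w j * (1 - load j))"
    using scaled_MWM_le_matching_bound[OF assms(1,2) ratio_le] .
  have supply_N: "matched_supply N \<subseteq> S" "finite (matched_supply N)"
    using matched_supply_subset[OF matching_N] finite_supply by (auto intro: finite_subset)
  have prob: "measure_pmf.prob \<mu> {M. j \<in> matched_supply M} = load j" if "j \<in> S" for j
    using prob_matched_eq_supply_load[OF finite_demand first_stage that] .
  have finite_\<mu>: "finite (set_pmf \<mu>)"
    using finite_demand finite_supply first_stage by (rule finite_set_pmf_first_stage)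
  have finite_\<kappa>: "finite (set_pmf (\<kappa> M))" if "M \<in> set_pmf \<mu>" for M
    using \<open>finite T\<close> finite_supply second_stage[OF that]
    by (intro finite_set_pmf_max_weight_matchings[of T "S - matched_supply M"]) auto
  note MWM_le
  also have "(\<Sum>j\<in>S. w j * load j) + (\<Sum>j\<in>matched_supply N. w j * (1 - load j))
      = measure_pmf.expectation \<mu>
          (\<lambda>M. sum w (S \<inter> matched_supply M) + sum w (matched_supply N - matched_supply M))"
    using supply_N finite_supply finite_\<mu>
    by (simp add: integrable_measure_pmf_finite expectation_sum_random_subset
        expectation_sum_random_Diff prob subset_iff)
  also have "\<dots> \<le> scenario_value S w \<mu> \<kappa>"
    unfolding scenario_value_def using finite_\<mu> finite_\<kappa> second_stage
    by (intro expectation_le_expectation_bind_pmf)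
      (auto intro: two_stage_matched_weight_ge[OF \<open>finite T\<close> finite_supply _ matching_N])
  finally show ?thesis .
qed

theorem mainTheorem11:
  fixes D\<^sub>1 D\<^sub>2 :: "'d set" and S :: "'s set" and E :: "('d \<times> 's) set"
    and w :: "'s \<Rightarrow> real" and \<pi> :: "'d \<Rightarrow> real" and g :: "real \<Rightarrow> real"
    and x :: "'d \<Rightarrow> 's \<Rightarrow> real" and \<mu> :: "('d \<times> 's) set pmf"
    and \<kappa> :: "('d \<times> 's) set \<Rightarrow> 'd set \<Rightarrow> ('d \<times> 's) set pmf" and y :: "'s \<Rightarrow> real"
  assumes "two_stage_instance D\<^sub>1 D\<^sub>2 S E w \<pi>"
    and "\<forall>t. g differentiable (at t)" and "mono g" and "strictly_convex g"
    and "wbu_optimal D\<^sub>1 S E w g x"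
    and "wbu_first_stage D\<^sub>1 S E x \<mu>"
    and "wbu_second_stage D\<^sub>2 S E w \<pi> \<mu> \<kappa>"
    and "\<forall>j\<in>S. y j = measure_pmf.prob \<mu> {M\<^sub>1. j \<in> matched_supply M\<^sub>1}"
  shows "wbu_value D\<^sub>2 S w \<pi> \<mu> \<kappa>
           \<ge> (MIN j\<in>S. 1 - y j + (y j)\<^sup>2) * OPT_offline D\<^sub>1 D\<^sub>2 S E w \<pi>"
proof -
  let ?P = "available_pmf D\<^sub>2 \<pi>"
  define c where "c = (MIN j\<in>S. 1 - y j + (y j)\<^sup>2)"
  have finite: "finite D\<^sub>1" "finite D\<^sub>2" "finite S" and disjoint: "D\<^sub>1 \<inter> D\<^sub>2 = {}"
    using assms(1) by (auto simp: two_stage_instance_def)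
  interpret wbu_optimum D\<^sub>1 S E w g x
    using assms(1,3,4,5) by unfold_locales (auto simp: two_stage_instance_def)
  have "load j = y j" if "j \<in> S" for j
    using prob_matched_eq_supply_load[OF finite(1) assms(6) that] assms(8) that by simp
  then have ratio_le: "c \<le> 1 - load j + (load j)\<^sup>2" if "j \<in> S" for j
    using that finite(3) by (auto simp: c_def intro: Min_le)
  have scenario: "c * MWM E w (D\<^sub>1 \<union> T) S \<le> scenario_value S w \<mu> (\<lambda>M. \<kappa> M T)"
    if "T \<in> set_pmf ?P" for T
    using available_pmf_subset[OF that] that finite(2) disjoint assms(6,7) ratio_le
    by (intro scaled_MWM_le_scenario_value) (auto simp: wbu_second_stage_def intro: finite_subset)
  have "c * OPT_offline D\<^sub>1 D\<^sub>2 S E w \<pi> = measure_pmf.expectation ?P (\<lambda>T. c * MWM E w (D\<^sub>1 \<union> T) S)"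
    by (simp add: OPT_offline_def)
  also have "\<dots> \<le> measure_pmf.expectation ?P (\<lambda>T. scenario_value S w \<mu> (\<lambda>M. \<kappa> M T))"
    by (intro expectation_pmf_mono_finite finite_set_available_pmf finite scenario)
  also have "\<dots> = wbu_value D\<^sub>2 S w \<pi> \<mu> \<kappa>"
    using finite finite_set_pmf_first_stage[OF finite(1,3) assms(6)] assms(7)
    by (simp only: wbu_value_eq_expectation_scenario_value)
  finally show ?thesis
    unfolding c_def .
qed

end
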